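(* Let $K$ be an alternating knot diagram with $n\ge 2$ crossings. Then any two crossings of $K$ are arc crossing change admissible; that is, for any two distinct crossings $x,y$ of $K$ there is a finite sequence of arc crossing changes, applied successively starting from $K$, whose total effect is to switch exactly the crossings $x$ and $y$ and to preserve all other crossings.
   Context: Knot diagrams are classical diagrams in the plane, with finitely many transverse double points equipped with over/under information. A diagram is alternating if over- and undercrossings alternate along the knot (the diagram is not assumed to be reduced). An arc of a knot diagram is a piece of the knot between two undercrossing points with no undercrossing points in between (it may pass over crossings in its interior). To switch a crossing means to exchange its over- and understrand. An arc crossing change applied to an arc switches the two crossings at the two endpoints of the arc and leaves all other crossings unchanged (for a knot diagram with at least two crossings these two crossings are distinct). Each operation in a sequence is applied to an arc of the diagram obtained from the previous operations. The underlying 4-valent plane graph is fixed throughout: no Reidemeister moves are performed. A subset $S$ of the set of crossings of a diagram is called arc crossing change admissible if there exists a sequence of arc crossing changes which switches each crossing in $S$ but preserves all others; two crossings $x,y$ are arc crossing change admissible if $S=\{x,y\}$ is. *)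

theory Defs
  imports "HOL-Analysis.Analysis"
begin

text \<open>
  The knot is parametrised by a curve of period 1 on the whole real line, so that the cyclic order
  along the knot becomes the linear order of parameters. Two parameters denote the same point of
  the knot iff they differ by an integer; a double point of the projection is a pair of parameters
  with the same image that do \<^emph>\<open>not\<close> differ by an integer.
\<close>

definition double_params :: "(real \<Rightarrow> real^2) \<Rightarrow> real \<Rightarrow> real \<Rightarrow> bool" where
  "double_params \<gamma> s t \<longleftrightarrow> \<gamma> s = \<gamma> t \<and> s - t \<notin> \<int>"

definition crossing_params :: "(real \<Rightarrow> real^2) \<Rightarrow> real set" where
  "crossing_params \<gamma> = {t. \<exists>s. double_params \<gamma> s t}"

definition knot_projection :: "(real \<Rightarrow> real^2) \<Rightarrow> bool" where
  "knot_projection \<gamma> \<longleftrightarrow>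
     (\<forall>t. \<gamma> (t + 1) = \<gamma> t) \<and>
     \<gamma> C1_differentiable_on UNIV \<and>
     (\<forall>t. vector_derivative \<gamma> (at t) \<noteq> 0) \<and>
     finite (\<gamma> ` crossing_params \<gamma>) \<and>
     \<comment> \<open>no point of the plane is passed through three times\<close>
     (\<forall>r s t. double_params \<gamma> r s \<longrightarrow> double_params \<gamma> s t \<longrightarrow> r - t \<in> \<int>) \<and>
     \<comment> \<open>transversality: the two tangent vectors are linearly independent\<close>
     (\<forall>s t. double_params \<gamma> s t \<longrightarrow>
        \<not> collinear {0, vector_derivative \<gamma> (at s), vector_derivative \<gamma> (at t)})"

text \<open>
  The over/under information is recorded as the set of parameters at which the knot passes under
  another strand; at the remaining crossing parameters it passes over.
\<close>

record knot_diagram =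
  curve :: "real \<Rightarrow> real^2"
  under :: "real set"

definition crossings :: "knot_diagram \<Rightarrow> (real^2) set" where
  "crossings D = curve D ` crossing_params (curve D)"

definition is_knot_diagram :: "knot_diagram \<Rightarrow> bool" where
  "is_knot_diagram D \<longleftrightarrow>
     knot_projection (curve D) \<and>
     under D \<subseteq> crossing_params (curve D) \<and>
     (\<forall>t. t + 1 \<in> under D \<longleftrightarrow> t \<in> under D) \<and>
     (\<forall>s t. double_params (curve D) s t \<longrightarrow> (s \<in> under D \<longleftrightarrow> t \<notin> under D))"

definition alternating :: "knot_diagram \<Rightarrow> bool" where
  "alternating D \<longleftrightarrow>
     (\<forall>s t. s \<in> crossing_params (curve D) \<longrightarrow> t \<in> crossing_params (curve D) \<longrightarrow> s < t \<longrightarrow>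
        {s<..<t} \<inter> crossing_params (curve D) = {} \<longrightarrow>
        (s \<in> under D \<longleftrightarrow> t \<notin> under D))"

text \<open>
  An arc is the image of an interval \<open>{s..t}\<close>, represented here by its endpoint parameters.
  Translating both by the same integer gives the same arc. If there is a single undercrossing then
  \<open>t = s + 1\<close> and the arc is the whole knot.
\<close>

definition diagram_arc :: "knot_diagram \<Rightarrow> real \<Rightarrow> real \<Rightarrow> bool" where
  "diagram_arc D s t \<longleftrightarrow>
     s < t \<and> s \<in> under D \<and> t \<in> under D \<and> {s<..<t} \<inter> under D = {}"

definition switch :: "(real^2) set \<Rightarrow> knot_diagram \<Rightarrow> knot_diagram" where
  "switch S D = D\<lparr>under := {t \<in> crossing_params (curve D). t \<in> under D \<longleftrightarrow> curve D t \<notin> S}\<rparr>"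

definition arc_crossing_change :: "knot_diagram \<Rightarrow> knot_diagram \<Rightarrow> bool" where
  "arc_crossing_change D D' \<longleftrightarrow>
     (\<exists>s t. diagram_arc D s t \<and> D' = switch {curve D s, curve D t} D)"

definition arc_crossing_change_admissible :: "knot_diagram \<Rightarrow> (real^2) set \<Rightarrow> bool" where
  "arc_crossing_change_admissible D S \<longleftrightarrow>
     S \<subseteq> crossings D \<and> arc_crossing_change\<^sup>*\<^sup>* D (switch S D)"

end

theory Submission
  imports Defs
begin

text \<open>
  Call the two crossings next to the overpass of a crossing \<open>c\<close> its successors \<open>\<tau>\<^sub>0 c\<close> and \<open>\<tau>\<^sub>1 c\<close>.
  By alternation both \<open>\<tau>\<^sub>0\<close> and \<open>\<tau>\<^sub>1\<close> are permutations of the crossings. Think of a switched pair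
  \<open>{x, y}\<close> as two tokens. The old overpass of \<open>x\<close> is now an underpass whose neighbours are the
  underpasses of \<open>\<tau>\<^sub>0 x\<close> and \<open>\<tau>\<^sub>1 x\<close>, so an arc crossing change moves the token \<open>x\<close> to
  \<open>\<tau>\<^sub>i x\<close> unless that place is taken. If \<open>\<tau>\<^sub>i x = y\<close>, moving first \<open>y\<close> and then \<open>x\<close> leads to
  \<open>{\<tau>\<^sub>i y, y}\<close>. So with \<open>y\<close> fixed, \<open>x\<close> can be moved by the permutation that \<open>\<tau>\<^sub>i\<close> induces on the
  crossings other than \<open>y\<close>. Such a permutation of a finite set preserves the set of those \<open>x\<close> for
  which \<open>{x, y}\<close> is not reachable. As \<open>y\<close> and its two neighbours along the underpasses form
  reachable pairs, that set is even closed under \<open>\<tau>\<^sub>0\<close> and \<open>\<tau>\<^sub>1\<close>, hence under moving to the next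
  underpass. Since it does not contain \<open>y\<close>, it is empty.
\<close>

section \<open>Permutations of a finite set with one point removed\<close>

text \<open>Short-circuiting \<open>f\<close> past \<open>y\<close> gives \<open>g\<close>,
  injective on \<open>X - {y}\<close>, which maps the finite set \<open>R\<close> into, hence onto,
  itself. So a value of \<open>g\<close> in \<open>R\<close> already has its preimage in
  \<open>R\<close>.\<close>

lemma punctured_permutation_complement:
  assumes "finite X" "inj_on f X" "f ` X \<subseteq> X" "y \<in> X" "R \<subseteq> X - {y}"
    and closed: "\<And>x. x \<in> R \<Longrightarrow> f x \<noteq> y \<Longrightarrow> f x \<in> R"
    and bounce: "\<And>x. x \<in> R \<Longrightarrow> f x = y \<Longrightarrow> f y \<in> R"
    and "x \<in> X - {y} - R" "f x \<noteq> y"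
  shows "f x \<notin> R"
proof
  assume fx: "f x \<in> R"
  define g where "g = (\<lambda>x. if f x = y then f y else f x)"
  have inj: "inj_on g (X - {y})"
    using assms(2,4) unfolding g_def inj_on_def by (metis Diff_iff singletonI)
  have "g ` R \<subseteq> R"
    using closed bounce by (auto simp: g_def)
  moreover have "inj_on g R" "finite R"
    using inj assms(1,5) by (auto intro: inj_on_subset finite_subset)
  ultimately have "g ` R = R"
    by (simp add: endo_inj_surj)
  then obtain r where "r \<in> R" "g r = f x"
    using fx by (metis imageE)
  moreover have "g x = f x"
    using assms(9) by (simp add: g_def)
  ultimately have "r = x"
    using inj assms(5,8) by (metis DiffD1 inj_onD subsetD)
  with \<open>r \<in> R\<close> assms(8) show False
    by blast
qed

text \<open>Switching a crossing twice restores it, so only crossings in exactly one of the two sets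
  change.\<close>

lemma switch_switch:
  "switch T (switch S D) = switch (S - T \<union> (T - S)) D"
proof -
  have "{t \<in> P. t \<in> {t \<in> P. t \<in> U \<longleftrightarrow> c t \<notin> S} \<longleftrightarrow> c t \<notin> T} =
      {t \<in> P. t \<in> U \<longleftrightarrow> c t \<notin> S - T \<union> (T - S)}" for P U :: "real set" and c :: "real \<Rightarrow> real^2"
    by blast
  then show ?thesis
    by (simp add: switch_def)
qed

section \<open>Periodicity and the two strands at a crossing\<close>

locale alternating_diagram =
  fixes K :: knot_diagram
  assumes diagram: "is_knot_diagram K" and alternating: "alternating K"
begin

abbreviation "\<gamma> \<equiv> curve K"
abbreviation "P \<equiv> crossing_params (curve K)"
abbreviation "U \<equiv> under K"

lemma projection: "knot_projection \<gamma>"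
  using diagram unfolding is_knot_diagram_def by blast

lemma under_subset: "U \<subseteq> P"
  using diagram unfolding is_knot_diagram_def by blast

lemma curve_plus_int: "\<gamma> (t + of_int k) = \<gamma> t"
proof -
  interpret periodic_fun_simple \<gamma> 1
    by unfold_locales (use projection in \<open>unfold knot_projection_def, blast\<close>)
  show ?thesis
    using plus_of_int[of t k] by simp
qed

lemma under_plus_int: "t + of_int k \<in> U \<longleftrightarrow> t \<in> U"
proof -
  interpret periodic_fun_simple "\<lambda>t. t \<in> U" 1
    by unfold_locales (use diagram in \<open>unfold is_knot_diagram_def, blast\<close>)
  show ?thesis
    using plus_of_int[of t k] by simp
qed

lemma double_params_partner:
  assumes "double_params \<gamma> s t"
  shows "s \<in> P" "t \<in> P" "s \<in> U \<longleftrightarrow> t \<notin> U"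
proof -
  have "double_params \<gamma> t s"
    using assms unfolding double_params_def by (metis Ints_minus minus_diff_eq)
  with assms show "s \<in> P" "t \<in> P" "s \<in> U \<longleftrightarrow> t \<notin> U"
    using diagram unfolding crossing_params_def is_knot_diagram_def by blast+
qed

lemma crossing_params_plus_int: "t + of_int k \<in> P \<longleftrightarrow> t \<in> P"
proof -
  have *: "t + of_int k \<in> P" if "t \<in> P" for t k
  proof -
    from that obtain s where s: "double_params \<gamma> s t"
      by (auto simp: crossing_params_def)
    have "double_params \<gamma> (s + of_int k) (t + of_int k)"
      using s by (simp add: double_params_def curve_plus_int)
    then show ?thesis
      by (auto simp: crossing_params_def)
  qed
  show ?thesis
    using *[of t k] *[of "t + of_int k" "- k"] by auto
qed

text \<open>The two strands of a double point have opposite status. This lifts equalities of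
  crossings to equalities of parameters modulo integers.\<close>

lemma same_strand:
  assumes "\<gamma> s = \<gamma> t" "s \<in> U \<longleftrightarrow> t \<in> U"
  shows "\<exists>k::int. t = s + of_int k"
proof -
  have "s - t \<in> \<int>"
    using assms double_params_partner(3)[of s t] by (auto simp: double_params_def)
  then obtain k where "s - t = of_int k"
    by (auto elim: Ints_cases)
  then have "t = s + of_int (- k)"
    by simp
  then show ?thesis ..
qed

lemma crossing_strands:
  assumes "c \<in> crossings K"
  obtains u v where "u \<in> U" "v \<in> P - U" "\<gamma> u = c" "\<gamma> v = c"
proof -
  from assms obtain s t where "double_params \<gamma> s t" "\<gamma> s = c" "\<gamma> t = c"
    by (auto simp: crossings_def crossing_params_def double_params_def)
  with double_params_partner[of s t] show thesis
    using that[of s t] that[of t s] by auto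
qed

lemma finite_crossings: "finite (crossings K)"
  using projection unfolding crossings_def knot_projection_def by blast

text \<open>Each of the finitely many crossings has just two parameter classes modulo integers, and
  each class is discrete.\<close>

lemma finite_params: "finite (P \<inter> {a..b})"
proof -
  have fin: "finite {t \<in> {a..b}. \<exists>k::int. t = r + of_int k}" for r
  proof -
    have "{t \<in> {a..b}. \<exists>k::int. t = r + of_int k} \<subseteq> (+) r ` {z \<in> \<int>. a - r \<le> z \<and> z \<le> b - r}"
    proof
      fix t assume "t \<in> {t \<in> {a..b}. \<exists>k::int. t = r + of_int k}"
      then obtain k :: int where "t = r + of_int k" "t \<in> {a..b}"
        by auto
      then show "t \<in> (+) r ` {z \<in> \<int>. a - r \<le> z \<and> z \<le> b - r}"
        by (intro image_eqI[of _ _ "of_int k"]) auto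
    qed
    then show ?thesis
      by (rule finite_subset) (intro finite_imageI finite_int_segment)
  qed
  have "finite {t \<in> P \<inter> {a..b}. \<gamma> t = c}" if "c \<in> crossings K" for c
  proof -
    from that obtain u v where uv: "u \<in> U" "v \<in> P - U" "\<gamma> u = c" "\<gamma> v = c"
      by (rule crossing_strands)
    have "{t \<in> P \<inter> {a..b}. \<gamma> t = c} \<subseteq>
        {t \<in> {a..b}. \<exists>k::int. t = u + of_int k} \<union> {t \<in> {a..b}. \<exists>k::int. t = v + of_int k}"
    proof
      fix t assume t: "t \<in> {t \<in> P \<inter> {a..b}. \<gamma> t = c}"
      then have "(u \<in> U \<longleftrightarrow> t \<in> U) \<or> (v \<in> U \<longleftrightarrow> t \<in> U)"
        using uv by blast
      then have "(\<exists>k::int. t = u + of_int k) \<or> (\<exists>k::int. t = v + of_int k)"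
        using same_strand[of u t] same_strand[of v t] uv t by auto
      with t show "t \<in> {t \<in> {a..b}. \<exists>k::int. t = u + of_int k} \<union> {t \<in> {a..b}. \<exists>k::int. t = v + of_int k}"
        by blast
    qed
    then show ?thesis
      by (rule finite_subset) (use fin in simp)
  qed
  then have "finite (\<Union>c\<in>crossings K. {t \<in> P \<inter> {a..b}. \<gamma> t = c})"
    using finite_crossings by blast
  then show ?thesis
    by (rule rev_finite_subset) (auto simp: crossings_def)
qed

section \<open>Consecutive crossing parameters along the knot\<close>

definition adjacent :: "real \<Rightarrow> real \<Rightarrow> bool" where
  "adjacent s t \<longleftrightarrow> s \<in> P \<and> t \<in> P \<and> s < t \<and> {s<..<t} \<inter> P = {}"

lemma adjacent_alternate: "adjacent s t \<Longrightarrow> s \<in> U \<longleftrightarrow> t \<notin> U"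
  using alternating unfolding adjacent_def alternating_def by blast

lemma adjacent_unique:
  "adjacent s t \<Longrightarrow> adjacent s t' \<Longrightarrow> t = t'"
  "adjacent s t \<Longrightarrow> adjacent s' t \<Longrightarrow> s = s'"
  unfolding adjacent_def by (metis disjoint_iff greaterThanLessThan_iff linorder_neqE)+

lemma adjacent_plus_int:
  assumes "adjacent s t"
  shows "adjacent (s + of_int k) (t + of_int k)"
proof -
  have "r \<notin> P" if "r \<in> {s + of_int k<..<t + of_int k}" for r
    using that assms crossing_params_plus_int[of "r - of_int k" k]
    by (auto simp: adjacent_def disjoint_iff algebra_simps)
  with assms show ?thesis
    by (auto simp: adjacent_def crossing_params_plus_int)
qed

lemma ex_next:
  assumes "t \<in> P"
  shows "\<exists>r. adjacent t r"
proof -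
  let ?A = "P \<inter> {t<..t + 1}"
  \<comment> \<open>After one full turn the same point recurs, so \<open>?A\<close> is nonempty and
    has a minimum.\<close>
  have "t + 1 \<in> ?A"
    using assms crossing_params_plus_int[of t 1] by simp
  moreover have "finite ?A"
    by (rule finite_subset[OF _ finite_params[of t "t + 1"]]) auto
  ultimately have "Min ?A \<in> ?A" "\<And>r. r \<in> ?A \<Longrightarrow> Min ?A \<le> r"
    by (metis Min_in empty_iff, metis Min_le)
  then have "adjacent t (Min ?A)"
    using assms unfolding adjacent_def by fastforce
  then show ?thesis ..
qed

lemma ex_prev:
  assumes "t \<in> P"
  shows "\<exists>r. adjacent r t"
proof -
  let ?A = "P \<inter> {t - 1..<t}"
  have "t - 1 \<in> ?A"
    using assms crossing_params_plus_int[of t "- 1"] by simp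
  moreover have "finite ?A"
    by (rule finite_subset[OF _ finite_params[of "t - 1" t]]) auto
  ultimately have "Max ?A \<in> ?A" "\<And>r. r \<in> ?A \<Longrightarrow> r \<le> Max ?A"
    by (metis Max_in empty_iff, metis Max_ge)
  then have "adjacent (Max ?A) t"
    using assms unfolding adjacent_def by fastforce
  then show ?thesis ..
qed

text \<open>By alternation \<open>w\<close> is the next underpass after \<open>u\<close>. Since the
  knot is one closed curve, passing from underpass to underpass meets every crossing.\<close>

lemma closed_under_next_under:
  assumes "C \<subseteq> crossings K" "c \<in> C"
    and step: "\<And>u v w. adjacent u v \<Longrightarrow> adjacent v w \<Longrightarrow> u \<in> U \<Longrightarrow> \<gamma> u \<in> C \<Longrightarrow> \<gamma> w \<in> C"
  shows "C = crossings K"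
proof
  have walk: "\<gamma> t \<in> C" if "u \<in> U" "\<gamma> u \<in> C" "t \<in> U" "u \<le> t" for u t
    using that
  proof (induction "card (P \<inter> {u..t})" arbitrary: u rule: less_induct)
    case less
    show ?case
    proof (cases "u = t")
      case False
      obtain v w where vw: "adjacent u v" "adjacent v w"
        using ex_next less.prems(1) under_subset by (meson adjacent_def subsetD)
      then have vU: "v \<notin> U" and wU: "w \<in> U"
        using adjacent_alternate less.prems(1) by blast+
      have tP: "t \<in> P"
        using less.prems(3) under_subset by blast
      have "v \<le> t"
        using vw(1) tP False less.prems(4) by (force simp: adjacent_def)
      then have "v < t"
        using vU less.prems(3) by (metis order_le_less)
      then have "w \<le> t"
        using vw(2) tP by (force simp: adjacent_def)
      have "u < w" "u \<in> P"
        using vw by (auto simp: adjacent_def)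
      then have "u \<in> P \<inter> {u..t} - P \<inter> {w..t}" "P \<inter> {w..t} \<subseteq> P \<inter> {u..t}"
        using less.prems(4) by auto
      then have "P \<inter> {w..t} \<subset> P \<inter> {u..t}"
        by blast
      then have "card (P \<inter> {w..t}) < card (P \<inter> {u..t})"
        by (rule psubset_card_mono[OF finite_params])
      then show ?thesis
        using less.hyps wU step[OF vw less.prems(1,2)] less.prems(3) \<open>w \<le> t\<close> by blast
    qed (use less.prems in simp)
  qed
  show "crossings K \<subseteq> C"
  proof
    fix d assume "d \<in> crossings K"
    then obtain t where t: "t \<in> U" "\<gamma> t = d"
      by (meson crossing_strands)
    obtain u where u: "u \<in> U" "\<gamma> u = c"
      using assms(1,2) by (meson crossing_strands subsetD)
    \<comment> \<open>The walk only runs forwards, so the target is first translated to lie at or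
      beyond \<open>u\<close>.\<close>
    have "u \<le> t + of_int \<lceil>u - t\<rceil>"
      by linarith
    with walk[of u "t + of_int \<lceil>u - t\<rceil>"] t u assms(2) show "d \<in> C"
      by (simp add: under_plus_int curve_plus_int)
  qed
qed (rule assms(1))

section \<open>The two successor permutations of the crossings\<close>

text \<open>The chosen lift is unique only up to integers; the neighbouring crossings do not depend
  on the choice.\<close>

definition over :: "real^2 \<Rightarrow> real" where
  "over c = (SOME t. t \<in> P - U \<and> \<gamma> t = c)"

text \<open>This is \<open>\<tau>\<^sub>0\<close>, and \<open>succ_cr\<close> is
  \<open>\<tau>\<^sub>1\<close>.\<close>

definition pred_cr :: "real^2 \<Rightarrow> real^2" where
  "pred_cr c = \<gamma> (SOME t. adjacent t (over c))"

definition succ_cr :: "real^2 \<Rightarrow> real^2" where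
  "succ_cr c = \<gamma> (SOME t. adjacent (over c) t)"

lemma over:
  assumes "c \<in> crossings K"
  shows "over c \<in> P - U" "\<gamma> (over c) = c"
proof -
  have "\<exists>t. t \<in> P - U \<and> \<gamma> t = c"
    using assms by (metis crossing_strands)
  from someI_ex[OF this] show "over c \<in> P - U" "\<gamma> (over c) = c"
    unfolding over_def by auto
qed

lemma pred_cr_eq:
  assumes "v \<in> P - U" "adjacent u v"
  shows "pred_cr (\<gamma> v) = \<gamma> u"
proof -
  have c: "\<gamma> v \<in> crossings K"
    using assms(1) by (auto simp: crossings_def)
  obtain k where k: "over (\<gamma> v) = v + of_int k"
    using same_strand[of v "over (\<gamma> v)"] over[OF c] assms(1) by auto
  have "(SOME t. adjacent t (over (\<gamma> v))) = u + of_int k"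
    using adjacent_plus_int[OF assms(2), of k] adjacent_unique(2)
    unfolding k by (intro some_equality)
  then show ?thesis
    by (simp add: pred_cr_def curve_plus_int)
qed

lemma succ_cr_eq:
  assumes "v \<in> P - U" "adjacent v w"
  shows "succ_cr (\<gamma> v) = \<gamma> w"
proof -
  have c: "\<gamma> v \<in> crossings K"
    using assms(1) by (auto simp: crossings_def)
  obtain k where k: "over (\<gamma> v) = v + of_int k"
    using same_strand[of v "over (\<gamma> v)"] over[OF c] assms(1) by auto
  have "(SOME t. adjacent (over (\<gamma> v)) t) = w + of_int k"
    using adjacent_plus_int[OF assms(2), of k] adjacent_unique(1)
    unfolding k by (intro some_equality)
  then show ?thesis
    by (simp add: succ_cr_def curve_plus_int)
qed

lemma over_neighbours:
  assumes "c \<in> crossings K"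
  obtains u v w where "adjacent u v" "adjacent v w" "u \<in> U" "v \<in> P - U" "w \<in> U" "\<gamma> v = c"
    "pred_cr c = \<gamma> u" "succ_cr c = \<gamma> w"
proof -
  have v: "over c \<in> P - U" "\<gamma> (over c) = c"
    using over[OF assms] .
  obtain u w where uw: "adjacent u (over c)" "adjacent (over c) w"
    using v(1) ex_next ex_prev by blast
  show thesis
  proof (rule that[OF uw _ v(1) _ v(2)])
    show "u \<in> U" "w \<in> U"
      using v(1) uw adjacent_alternate by blast+
    show "pred_cr c = \<gamma> u" "succ_cr c = \<gamma> w"
      using pred_cr_eq[OF v(1) uw(1)] succ_cr_eq[OF v(1) uw(2)] v(2) by simp_all
  qed
qed

lemma curve_under_in_crossings: "u \<in> U \<Longrightarrow> \<gamma> u \<in> crossings K"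
  using under_subset by (auto simp: crossings_def)

lemma pred_cr_in: "pred_cr ` crossings K \<subseteq> crossings K"
  by (rule image_subsetI, erule over_neighbours) (simp add: curve_under_in_crossings)

lemma succ_cr_in: "succ_cr ` crossings K \<subseteq> crossings K"
  by (rule image_subsetI, erule over_neighbours) (simp add: curve_under_in_crossings)

text \<open>The common value is met along its understrand, which is unique modulo integers and
  determines the overpass that follows it.\<close>

lemma inj_pred_cr: "inj_on pred_cr (crossings K)"
proof (rule inj_onI)
  fix c d assume c: "c \<in> crossings K" and d: "d \<in> crossings K" and eq: "pred_cr c = pred_cr d"
  obtain u v where 1: "adjacent u v" "u \<in> U" "\<gamma> v = c" "pred_cr c = \<gamma> u"
    using over_neighbours[OF c] .
  obtain u' v' where 2: "adjacent u' v'" "u' \<in> U" "\<gamma> v' = d" "pred_cr d = \<gamma> u'"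
    using over_neighbours[OF d] .
  note * = 1 2
  obtain k where "u' = u + of_int k"
    using same_strand[of u u'] * eq by auto
  then have "v' = v + of_int k"
    using * adjacent_plus_int adjacent_unique(1) by blast
  with * show "c = d"
    by (metis curve_plus_int)
qed

lemma inj_succ_cr: "inj_on succ_cr (crossings K)"
proof (rule inj_onI)
  fix c d assume c: "c \<in> crossings K" and d: "d \<in> crossings K" and eq: "succ_cr c = succ_cr d"
  obtain v w where 1: "adjacent v w" "w \<in> U" "\<gamma> v = c" "succ_cr c = \<gamma> w"
    using over_neighbours[OF c] .
  obtain v' w' where 2: "adjacent v' w'" "w' \<in> U" "\<gamma> v' = d" "succ_cr d = \<gamma> w'"
    using over_neighbours[OF d] .
  note * = 1 2
  obtain k where "w' = w + of_int k"
    using same_strand[of w w'] * eq by auto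
  then have "v' = v + of_int k"
    using * adjacent_plus_int adjacent_unique(2) by blast
  with * show "c = d"
    by (metis curve_plus_int)
qed

text \<open>\<open>pred_cr\<close> permutes the finite set \<open>C\<close>, so it can be inverted
  there: from an underpass on to the overpass after it, then by \<open>succ_cr\<close> to the next
  underpass.\<close>

lemma closed_under_pred_succ:
  assumes "C \<subseteq> crossings K" "c \<in> C" "pred_cr ` C \<subseteq> C" "succ_cr ` C \<subseteq> C"
  shows "C = crossings K"
proof (rule closed_under_next_under[OF assms(1,2)])
  fix u v w assume uvw: "adjacent u v" "adjacent v w" "u \<in> U" "\<gamma> u \<in> C"
  then have v: "v \<in> P - U"
    using adjacent_alternate by (auto simp: adjacent_def)
  then have vc: "\<gamma> v \<in> crossings K"
    by (auto simp: crossings_def)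
  have "pred_cr ` C = C"
    using assms finite_crossings inj_pred_cr
    by (meson endo_inj_surj finite_subset inj_on_subset)
  moreover have "pred_cr (\<gamma> v) = \<gamma> u"
    using v uvw(1) by (rule pred_cr_eq)
  ultimately obtain d where d: "d \<in> C" "pred_cr d = pred_cr (\<gamma> v)"
    using uvw(4) by (metis imageE)
  have "d = \<gamma> v"
    by (rule inj_onD[OF inj_pred_cr d(2)]) (use d(1) assms(1) vc in auto)
  then have "succ_cr (\<gamma> v) \<in> C"
    using d(1) assms(4) by blast
  then show "\<gamma> w \<in> C"
    by (simp add: succ_cr_eq[OF v uvw(2)])
qed

text \<open>If both neighbours coincide, the step to the next underpass never leaves that one
  crossing, which would then be the only one.\<close>

lemma pred_cr_neq_succ_cr:
  assumes "c \<in> crossings K" "card (crossings K) \<ge> 2"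
  shows "pred_cr c \<noteq> succ_cr c"
proof
  assume eq: "pred_cr c = succ_cr c"
  obtain u v w where uvw: "adjacent u v" "adjacent v w" "u \<in> U" "v \<in> P - U" "w \<in> U" "\<gamma> v = c"
    "pred_cr c = \<gamma> u" "succ_cr c = \<gamma> w"
    using over_neighbours[OF assms(1)] .
  have "{\<gamma> u} = crossings K"
  proof (rule closed_under_next_under[of _ "\<gamma> u"])
    fix u' v' w' assume *: "adjacent u' v'" "adjacent v' w'" "u' \<in> U" "\<gamma> u' \<in> {\<gamma> u}"
    then obtain k where "u' = u + of_int k"
      using same_strand[of u u'] uvw(3) by auto
    then have "w' = w + of_int k"
      using * uvw(1,2) adjacent_plus_int adjacent_unique(1) by blast
    then show "\<gamma> w' \<in> {\<gamma> u}"
      using eq uvw(7,8) by (simp add: curve_plus_int)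
  qed (use uvw(3) under_subset in \<open>auto simp: crossings_def\<close>)
  then show False
    using assms(2) by (metis card_1_singleton_iff numeral_le_one_iff One_nat_def semiring_norm(69))
qed

section \<open>Token moves by arc crossing changes\<close>

definition reachable :: "real^2 \<Rightarrow> real^2 \<Rightarrow> bool" where
  "reachable x y \<longleftrightarrow> arc_crossing_change\<^sup>*\<^sup>* K (switch {x, y} K)"

lemma reachable_sym: "reachable x y \<Longrightarrow> reachable y x"
  by (simp add: reachable_def insert_commute)

text \<open>The switch at \<open>a\<close> turned the overpass \<open>v\<close> into an underpass,
  so \<open>u\<close> and \<open>v\<close> bound an arc; changing it restores \<open>a\<close> and
  switches \<open>\<gamma> u\<close>.\<close>

lemma token_move:
  assumes "reachable a b" "a \<noteq> b" "v \<in> P - U" "\<gamma> v = a" "u \<in> U" "adjacent u v \<or> adjacent v u" "\<gamma> u \<noteq> b"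
  shows "reachable (\<gamma> u) b"
proof (cases "\<gamma> u = a")
  case False
  let ?D = "switch {a, b} K"
  have under_D: "under ?D = {t \<in> P. t \<in> U \<longleftrightarrow> \<gamma> t \<notin> {a, b}}" and curve_D: "curve ?D = \<gamma>"
    by (auto simp: switch_def)
  have "v \<in> under ?D" "u \<in> under ?D"
    using assms False under_subset unfolding under_D by auto
  moreover have "{r<..<s} \<inter> under ?D = {}" if "adjacent r s" for r s
    using that unfolding under_D adjacent_def by blast
  ultimately have "diagram_arc ?D u v \<or> diagram_arc ?D v u"
    using assms(6) unfolding diagram_arc_def adjacent_def by blast
  moreover have "{\<gamma> v, \<gamma> u} = {\<gamma> u, \<gamma> v}"
    by (rule insert_commute)
  ultimately have arc: "arc_crossing_change ?D (switch {\<gamma> u, \<gamma> v} ?D)"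
    unfolding arc_crossing_change_def curve_D by force
  have "{a, b} - {p, a} \<union> ({p, a} - {a, b}) = {p, b}" if "p \<noteq> a" "p \<noteq> b" for p
    using that assms(2) by blast
  from this[OF False assms(7)]
  have "switch {\<gamma> u, \<gamma> v} ?D = switch {\<gamma> u, b} K"
    by (simp only: switch_switch assms(4))
  with arc have "arc_crossing_change ?D (switch {\<gamma> u, b} K)"
    by (simp only:)
  with assms(1) show ?thesis
    unfolding reachable_def by (rule rtranclp.rtrancl_into_rtrancl)
\<comment> \<open>At a loop, the adjacent \<open>u\<close> and \<open>v\<close> are the two strands
  of one crossing, and the token stays.\<close>
qed (use assms(1) in simp)

lemma reachable_pred_cr:
  assumes "reachable a b" "a \<noteq> b" "a \<in> crossings K" "pred_cr a \<noteq> b"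
  shows "reachable (pred_cr a) b"
proof (rule over_neighbours[OF assms(3)])
  fix u v w assume "adjacent u v" "adjacent v w" "u \<in> U" "v \<in> P - U" "w \<in> U" "\<gamma> v = a"
    "pred_cr a = \<gamma> u" "succ_cr a = \<gamma> w"
  with token_move[OF assms(1,2), of v u] assms(4) show ?thesis
    by simp
qed

lemma reachable_succ_cr:
  assumes "reachable a b" "a \<noteq> b" "a \<in> crossings K" "succ_cr a \<noteq> b"
  shows "reachable (succ_cr a) b"
proof (rule over_neighbours[OF assms(3)])
  fix u v w assume "adjacent u v" "adjacent v w" "u \<in> U" "v \<in> P - U" "w \<in> U" "\<gamma> v = a"
    "pred_cr a = \<gamma> u" "succ_cr a = \<gamma> w"
  with token_move[OF assms(1,2), of v w] assms(4) show ?thesis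
    by simp
qed

text \<open>In \<open>K\<close> itself the overpass of \<open>c\<close> lies inside a single arc
  that ends at the two neighbouring underpasses. One move thus yields the starting pairs.\<close>

lemma reachable_pred_succ:
  assumes "c \<in> crossings K"
  shows "reachable (pred_cr c) (succ_cr c)"
proof -
  obtain u v w where uvw: "adjacent u v" "adjacent v w" "u \<in> U" "v \<in> P - U" "w \<in> U" "\<gamma> v = c"
    "pred_cr c = \<gamma> u" "succ_cr c = \<gamma> w"
    using over_neighbours[OF assms] .
  have "{u<..<w} \<subseteq> {u<..<v} \<union> {v} \<union> {v<..<w}"
    by auto
  moreover have "{u<..<v} \<inter> P = {}" "{v<..<w} \<inter> P = {}" "u < w"
    using uvw(1,2) by (auto simp: adjacent_def)
  ultimately have "diagram_arc K u w"
    using uvw(3-5) under_subset unfolding diagram_arc_def by blast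
  then have "arc_crossing_change K (switch {\<gamma> u, \<gamma> w} K)"
    unfolding arc_crossing_change_def by blast
  then show ?thesis
    unfolding reachable_def uvw(7,8) by (rule r_into_rtranclp)
qed

text \<open>If \<open>y\<close> occupies the target of \<open>x\<close>, move \<open>y\<close> to
  \<open>f y\<close> first and then \<open>x\<close> to \<open>y\<close>; if \<open>f y = x\<close>,
  the pair is already there. Injectivity excludes \<open>f y = y\<close>.\<close>

lemma reachable_bounce:
  assumes "inj_on f (crossings K)"
    and step: "\<And>a b. \<lbrakk>reachable a b; a \<noteq> b; a \<in> crossings K; f a \<noteq> b\<rbrakk> \<Longrightarrow> reachable (f a) b"
    and "reachable x y" "x \<noteq> y" "x \<in> crossings K" "y \<in> crossings K" "f x = y"
  shows "f y \<noteq> y" "reachable (f y) y"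
proof -
  show neq: "f y \<noteq> y"
  proof
    assume "f y = y"
    then have "x = y"
      using inj_onD[OF assms(1)] assms(5-7) by metis
    with assms(4) show False ..
  qed
  show "reachable (f y) y"
  proof (cases "f y = x")
    case False
    have "reachable (f y) x"
      by (rule step[OF reachable_sym[OF assms(3)] assms(4)[symmetric] assms(6) False])
    then have "reachable (f x) (f y)"
      by (rule step[OF reachable_sym False[symmetric] assms(5)]) (use assms(7) neq in simp)
    then show ?thesis
      unfolding assms(7) by (rule reachable_sym)
  qed (use assms(3) in simp)
qed

section \<open>Reachability of all pairs\<close>

lemma all_pairs_reachable:
  assumes "card (crossings K) \<ge> 2" "x \<in> crossings K" "y \<in> crossings K" "x \<noteq> y"
  shows "reachable x y"
proof (rule ccontr)
  assume nr: "\<not> reachable x y"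
  let ?X = "crossings K"
  define R where "R = {z \<in> ?X - {y}. reachable z y}"
  define C where "C = ?X - {y} - R"
  \<comment> \<open>Stated for a general \<open>f\<close> to serve both \<open>pred_cr\<close> and
    \<open>succ_cr\<close>. Bouncing off \<open>y\<close> makes \<open>R\<close> invariant under the
    punctured permutation.\<close>
  have escape: "f z \<notin> R" if "z \<in> C" "f z \<noteq> y" "inj_on f ?X" "f ` ?X \<subseteq> ?X"
    and step: "\<And>a b. \<lbrakk>reachable a b; a \<noteq> b; a \<in> ?X; f a \<noteq> b\<rbrakk> \<Longrightarrow> reachable (f a) b" for f z
  proof (rule punctured_permutation_complement[OF finite_crossings that(3,4) assms(3)])
    show "f a \<in> R" if "a \<in> R" "f a \<noteq> y" for a
      using that step \<open>f ` ?X \<subseteq> ?X\<close> by (auto simp: R_def)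
    show "f y \<in> R" if "a \<in> R" "f a = y" for a
      using reachable_bounce[OF \<open>inj_on f ?X\<close> step, of a y] that assms(3) \<open>f ` ?X \<subseteq> ?X\<close>
      by (auto simp: R_def)
  qed (use that in \<open>auto simp: C_def R_def\<close>)
  have pred: "pred_cr z \<notin> R" if "z \<in> C" "pred_cr z \<noteq> y" for z
    using escape[OF that inj_pred_cr pred_cr_in reachable_pred_cr] .
  have succ: "succ_cr z \<notin> R" if "z \<in> C" "succ_cr z \<noteq> y" for z
    using escape[OF that inj_succ_cr succ_cr_in reachable_succ_cr] .
  have "pred_cr z \<in> C \<and> succ_cr z \<in> C" if z: "z \<in> C" for z
  proof -
    have zX: "z \<in> ?X"
      using z by (simp add: C_def)
    note neq = pred_cr_neq_succ_cr[OF zX assms(1)]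
    have X: "pred_cr z \<in> ?X" "succ_cr z \<in> ?X"
      using zX pred_cr_in succ_cr_in by auto
    \<comment> \<open>If \<open>pred_cr z = y\<close>, the one-move pair of neighbours of
      \<open>z\<close> puts \<open>succ_cr z\<close> in \<open>R\<close>, against
      \<open>succ\<close>; distinctness of the neighbours gives \<open>succ_cr z \<noteq> y\<close>.
      The other case is symmetric.\<close>
    have "pred_cr z \<noteq> y"
      using succ[OF z] neq X reachable_sym[OF reachable_pred_succ[OF zX]] by (auto simp: R_def)
    moreover have "succ_cr z \<noteq> y"
      using pred[OF z] neq X reachable_pred_succ[OF zX] by (auto simp: R_def)
    ultimately show ?thesis
      using pred succ z X by (auto simp: C_def)
  qed
  then have "pred_cr ` C \<subseteq> C" "succ_cr ` C \<subseteq> C"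
    by blast+
  moreover have "C \<subseteq> ?X" "x \<in> C"
    using nr assms(2,4) unfolding C_def R_def by blast+
  ultimately have "C = ?X"
    by (intro closed_under_pred_succ)
  then show False
    using assms(3) by (auto simp: C_def)
qed

end

theorem theorem1p4:
  fixes K :: knot_diagram and n :: nat and x y :: "real^2"
  assumes "is_knot_diagram K"
    and "alternating K"
    and "card (crossings K) = n"
    and "n \<ge> 2"
    and "x \<in> crossings K"
    and "y \<in> crossings K"
    and "x \<noteq> y"
  shows "arc_crossing_change_admissible K {x, y}"
proof -
  interpret alternating_diagram K
    using assms(1,2) by unfold_locales
  show ?thesis
    using all_pairs_reachable[of x y] assms
    by (simp add: arc_crossing_change_admissible_def reachable_def)
qed

end
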